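(* Let $R$ be a ring. Then the following are equivalent: (1) $R$ is a CUNC-ring. (2) $R$ is an abelian UU-ring.
   Context: All rings are associative with identity (not necessarily commutative). $U(R)$, $\mathrm{nil}(R)$, $\mathrm{idem}(R)$ denote the sets of units, nilpotents and idempotents of $R$. An element $r\in R$ is clean if $r=u+e$ for some $u\in U(R)$ and $e\in\mathrm{idem}(R)$. An element $r\in R$ is uniquely nil-clean if there is exactly one pair $(q,e)\in\mathrm{nil}(R)\times\mathrm{idem}(R)$ with $r=q+e$. $R$ is a CUNC-ring if every clean element of $R$ is uniquely nil-clean. $R$ is abelian if all its idempotents are central. $R$ is a UU-ring if $U(R)=1+\mathrm{nil}(R)$. *)

theory Defs
  imports "HOL-Algebra.Ring"
begin

(* Throughout, R is meant to satisfy the locale predicate ring of HOL-Algebra: associative, with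
   identity, not necessarily commutative; the zero ring is allowed.  U(R) is Units R. *)

definition nilpotents :: "('a, 'm) ring_scheme \<Rightarrow> 'a set" where
  "nilpotents R = {x \<in> carrier R. \<exists>n::nat. n > 0 \<and> x [^]\<^bsub>R\<^esub> n = \<zero>\<^bsub>R\<^esub>}"

definition idempotents :: "('a, 'm) ring_scheme \<Rightarrow> 'a set" where
  "idempotents R = {e \<in> carrier R. e \<otimes>\<^bsub>R\<^esub> e = e}"

definition clean_element :: "('a, 'm) ring_scheme \<Rightarrow> 'a \<Rightarrow> bool" where
  "clean_element R r \<longleftrightarrow> (\<exists>u \<in> Units R. \<exists>e \<in> idempotents R. r = u \<oplus>\<^bsub>R\<^esub> e)"

definition uniquely_nil_clean_element :: "('a, 'm) ring_scheme \<Rightarrow> 'a \<Rightarrow> bool" where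
  "uniquely_nil_clean_element R r \<longleftrightarrow>
     (\<exists>!p. p \<in> nilpotents R \<times> idempotents R \<and> r = fst p \<oplus>\<^bsub>R\<^esub> snd p)"

definition CUNC_ring :: "('a, 'm) ring_scheme \<Rightarrow> bool" where
  "CUNC_ring R \<longleftrightarrow> ring R \<and>
     (\<forall>r \<in> carrier R. clean_element R r \<longrightarrow> uniquely_nil_clean_element R r)"

(* Here "abelian" says that idempotents are central; it is unrelated to commutativity of addition
   (the locale abelian_group) and weaker than commutativity of multiplication (cring). *)
definition abelian_ring :: "('a, 'm) ring_scheme \<Rightarrow> bool" where
  "abelian_ring R \<longleftrightarrow> ring R \<and>
     (\<forall>e \<in> idempotents R. \<forall>x \<in> carrier R. e \<otimes>\<^bsub>R\<^esub> x = x \<otimes>\<^bsub>R\<^esub> e)"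

definition UU_ring :: "('a, 'm) ring_scheme \<Rightarrow> bool" where
  "UU_ring R \<longleftrightarrow> ring R \<and> Units R = (\<lambda>q. \<one>\<^bsub>R\<^esub> \<oplus>\<^bsub>R\<^esub> q) ` nilpotents R"

end

theory Submission
  imports Defs
begin

text \<open>
  In a CUNC-ring, conjugating the decomposition \<open>u = q + e\<close> of a unit by \<open>u\<close> gives another one,
  so \<open>e\<close> commutes with \<open>u\<close>; since \<open>u (1 - e) = q (1 - e)\<close> and \<open>q\<close> is nilpotent, \<open>e = 1\<close>.
  An idempotent \<open>e = (e - (1 - e)) + (1 - e)\<close> is clean, and if \<open>n\<close> is \<open>e x (1 - e)\<close> or
  \<open>(1 - e) x e\<close> then \<open>e = 0 + e = (-n) + (e + n)\<close>, so \<open>n = 0\<close> and \<open>e\<close> is central.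
  Conversely, in a UU-ring \<open>2\<close> is nilpotent because \<open>-1\<close> is a unit, so in an abelian UU-ring
  \<open>(1 + q) + e = (q + 2 e) + (1 - e)\<close> is nil-clean. This decomposition is unique because the
  difference \<open>d\<close> of two central idempotents satisfies \<open>d\<^sup>3 = d\<close>, hence vanishes if it is nilpotent.
\<close>

context ring
begin

section \<open>Arithmetic of nilpotents, units and idempotents\<close>

lemma eq_if_minus_zero:
  assumes "x \<in> carrier R" "y \<in> carrier R" "x \<ominus> y = \<zero>"
  shows "x = y"
proof -
  have "x = x \<ominus> y \<oplus> y" using assms(1,2) by (simp add: minus_eq a_assoc l_neg)
  then show ?thesis using assms by simp
qed

lemma idempotent_pow:
  assumes "e \<in> carrier R" "e \<otimes> e = e" "n > 0"
  shows "e [^] (n::nat) = e"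
  using assms(3)
proof (induction n)
  \<comment> \<open>The induction hypothesis speaks of positive exponents only, since
    \<open>e [^] 0\<close> is \<open>\<one>\<close>; hence exponent one is split off.\<close>
  case (Suc n)
  then show ?case using assms by (cases "n = 0") auto
qed simp

lemma idempotent_nilpotent_eq_zero:
  assumes "e \<in> nilpotents R" "e \<in> idempotents R"
  shows "e = \<zero>"
proof -
  obtain n :: nat where "n > 0" "e [^] n = \<zero>" using assms(1) unfolding nilpotents_def by auto
  then show ?thesis
    using assms(2) idempotent_pow[of e n] unfolding idempotents_def by auto
qed

lemma pow_eq_zero_mono:
  assumes "x \<in> carrier R" "x [^] (n::nat) = \<zero>" "n \<le> m"
  shows "x [^] (m::nat) = \<zero>"
proof -
  have "x [^] m = x [^] (n + (m - n))" using assms(3) by simp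
  also have "\<dots> = x [^] n \<otimes> x [^] (m - n)" using nat_pow_mult[OF assms(1)] by simp
  finally show ?thesis using assms by simp
qed

text \<open>This replaces the binomial expansion of a power of \<open>x \<oplus> y\<close>.
  Splitting off one factor of the sum moves it into the power of \<open>x\<close> or of
  \<open>y\<close>, so \<open>a + b + k\<close> is preserved; once \<open>k\<close> is used up, one
  of the two powers is large enough to vanish. The statement carries \<open>a\<close> and
  \<open>b\<close> for this induction; the application takes both to be 0.\<close>

lemma commuting_add_pow_eq_zero:
  assumes x: "x \<in> carrier R" and y: "y \<in> carrier R" and xy: "x \<otimes> y = y \<otimes> x"
    and n: "x [^] (n::nat) = \<zero>" and m: "y [^] (m::nat) = \<zero>"
  shows "n + m \<le> a + b + k \<Longrightarrow> x [^] (a::nat) \<otimes> y [^] (b::nat) \<otimes> (x \<oplus> y) [^] (k::nat) = \<zero>"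
proof (induction k arbitrary: a b)
  case 0
  then have "n \<le> a \<or> m \<le> b" by linarith
  then have "x [^] a = \<zero> \<or> y [^] b = \<zero>" using pow_eq_zero_mono x y n m by blast
  then show ?case using x y by auto
next
  case (Suc k)
  let ?s = "x \<oplus> y"
  have "?s [^] Suc k = ?s \<otimes> ?s [^] k" using x y by (intro nat_pow_Suc2) simp
  then have "x [^] a \<otimes> y [^] b \<otimes> ?s [^] Suc k
      = x [^] a \<otimes> (y [^] b \<otimes> x) \<otimes> ?s [^] k \<oplus> x [^] a \<otimes> (y [^] b \<otimes> y) \<otimes> ?s [^] k"
    using x y by (simp add: m_assoc l_distr r_distr)
  also have "y [^] b \<otimes> x = x \<otimes> y [^] b" using group_commutes_pow[OF _ y x] xy by simp
  also have "x [^] a \<otimes> (x \<otimes> y [^] b) \<otimes> ?s [^] k = x [^] Suc a \<otimes> y [^] b \<otimes> ?s [^] k"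
    using x y by (simp add: m_assoc)
  also have "\<dots> = \<zero>" by (rule Suc.IH) (use Suc.prems in simp)
  also have "x [^] a \<otimes> (y [^] b \<otimes> y) \<otimes> ?s [^] k = x [^] a \<otimes> y [^] Suc b \<otimes> ?s [^] k"
    by simp
  also have "\<dots> = \<zero>" by (rule Suc.IH) (use Suc.prems in simp)
  finally show ?case by simp
qed

lemma nilpotent_add:
  assumes "x \<in> nilpotents R" "y \<in> nilpotents R" "x \<otimes> y = y \<otimes> x"
  shows "x \<oplus> y \<in> nilpotents R"
proof -
  obtain n m :: nat where nm: "n > 0" "x [^] n = \<zero>" "y [^] m = \<zero>"
    and c: "x \<in> carrier R" "y \<in> carrier R"
    using assms unfolding nilpotents_def by auto
  have "(x \<oplus> y) [^] (n + m) = \<zero>"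
    using commuting_add_pow_eq_zero[of x y n m 0 0 "n + m"] nm c assms(3) by simp
  then show ?thesis using nm(1) c unfolding nilpotents_def by blast
qed

lemma nilpotent_mult:
  assumes "x \<in> nilpotents R" "y \<in> carrier R" "x \<otimes> y = y \<otimes> x"
  shows "x \<otimes> y \<in> nilpotents R"
proof -
  obtain n :: nat where n: "n > 0" "x [^] n = \<zero>" and c: "x \<in> carrier R"
    using assms unfolding nilpotents_def by auto
  have "(x \<otimes> y) [^] n = \<zero>" using pow_mult_distrib[OF assms(3) c assms(2)] n assms(2) by simp
  then show ?thesis using n(1) c assms(2) unfolding nilpotents_def by auto
qed

lemma nilpotent_minus:
  assumes "x \<in> nilpotents R"
  shows "\<ominus> x \<in> nilpotents R"
proof -
  have c: "x \<in> carrier R" using assms unfolding nilpotents_def by auto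
  have "x \<otimes> (\<ominus> \<one>) \<in> nilpotents R"
    using assms c by (intro nilpotent_mult) (simp_all add: l_minus r_minus)
  then show ?thesis using c by (simp add: r_minus)
qed

lemma square_zero_nilpotent:
  assumes "x \<in> carrier R" "x \<otimes> x = \<zero>"
  shows "x \<in> nilpotents R"
proof -
  have "x [^] (2::nat) = \<zero>" using assms by (simp add: numeral_2_eq_2)
  then show ?thesis using assms(1) unfolding nilpotents_def by (intro CollectI conjI exI[of _ 2]) auto
qed

lemma zero_nilpotent: "\<zero> \<in> nilpotents R"
  by (rule square_zero_nilpotent) simp_all

text \<open>The witness is the sum of the powers of \<open>q\<close> with exponent below
  \<open>n\<close>. Both orders of multiplication are recorded because a unit needs a two-sided
  inverse.\<close>

lemma geometric_sum:
  assumes q: "q \<in> carrier R"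
  shows "\<exists>s \<in> carrier R. (\<one> \<oplus> \<ominus> q) \<otimes> s = \<one> \<oplus> \<ominus> (q [^] (n::nat)) \<and> s \<otimes> (\<one> \<oplus> \<ominus> q) = \<one> \<oplus> \<ominus> (q [^] n)"
proof (induction n)
  case 0
  then show ?case using q by (intro bexI[of _ "\<zero>"]) (auto simp: r_neg)
next
  case (Suc n)
  then obtain s where s: "s \<in> carrier R" "(\<one> \<oplus> \<ominus> q) \<otimes> s = \<one> \<oplus> \<ominus> (q [^] n)"
    "s \<otimes> (\<one> \<oplus> \<ominus> q) = \<one> \<oplus> \<ominus> (q [^] n)" by blast
  have "(\<one> \<oplus> \<ominus> q) \<otimes> (s \<oplus> q [^] n) = \<one> \<oplus> \<ominus> (q [^] n) \<oplus> (q [^] n \<oplus> \<ominus> (q \<otimes> q [^] n))"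
    using s q by (simp add: r_distr) (simp add: l_distr l_minus)
  also have "\<dots> = \<one> \<oplus> \<ominus> (q [^] Suc n)"
    using q unfolding nat_pow_Suc2[OF q] by (simp add: a_assoc r_neg1)
  finally have l: "(\<one> \<oplus> \<ominus> q) \<otimes> (s \<oplus> q [^] n) = \<one> \<oplus> \<ominus> (q [^] Suc n)" .
  have "(s \<oplus> q [^] n) \<otimes> (\<one> \<oplus> \<ominus> q) = \<one> \<oplus> \<ominus> (q [^] n) \<oplus> (q [^] n \<oplus> \<ominus> (q [^] n \<otimes> q))"
    using s q by (simp add: l_distr) (simp add: r_distr r_minus)
  also have "\<dots> = \<one> \<oplus> \<ominus> (q [^] Suc n)"
    using q by (simp add: a_assoc r_neg1)
  finally have r: "(s \<oplus> q [^] n) \<otimes> (\<one> \<oplus> \<ominus> q) = \<one> \<oplus> \<ominus> (q [^] Suc n)" .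
  show ?case using l r s(1) q by (intro bexI[of _ "s \<oplus> q [^] n"]) auto
qed

lemma one_plus_nilpotent_Unit:
  assumes "q \<in> nilpotents R"
  shows "\<one> \<oplus> q \<in> Units R"
proof -
  have c: "q \<in> carrier R" using assms unfolding nilpotents_def by auto
  obtain n :: nat where n: "(\<ominus> q) [^] n = \<zero>"
    using nilpotent_minus[OF assms] unfolding nilpotents_def by auto
  have "\<exists>s \<in> carrier R. (\<one> \<oplus> q) \<otimes> s = \<one> \<and> s \<otimes> (\<one> \<oplus> q) = \<one>"
    \<comment> \<open>The geometric sum of \<open>\<ominus> q\<close> inverts
      \<open>\<one> \<oplus> q\<close>, as the remainder \<open>(\<ominus> q) [^] n\<close>
      vanishes.\<close>
    using geometric_sum[of "\<ominus> q" n] c n by simp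
  then show ?thesis using c unfolding Units_def by auto
qed

lemma one_minus_idempotent:
  assumes "e \<in> idempotents R"
  shows "\<one> \<ominus> e \<in> idempotents R" "e \<otimes> (\<one> \<ominus> e) = \<zero>" "(\<one> \<ominus> e) \<otimes> e = \<zero>"
proof -
  have e: "e \<in> carrier R" "e \<otimes> e = e" using assms unfolding idempotents_def by auto
  show 1: "e \<otimes> (\<one> \<ominus> e) = \<zero>" and "(\<one> \<ominus> e) \<otimes> e = \<zero>"
    using e by (simp_all add: minus_eq r_distr l_distr r_minus l_minus r_neg)
  have "(\<one> \<ominus> e) \<otimes> (\<one> \<ominus> e) = \<one> \<otimes> (\<one> \<ominus> e) \<ominus> e \<otimes> (\<one> \<ominus> e)"
    using e by (simp add: minus_eq l_distr l_minus)
  then show "\<one> \<ominus> e \<in> idempotents R" using e 1 unfolding idempotents_def by (simp add: minus_eq)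
qed

section \<open>CUNC-rings are abelian UU-rings\<close>

lemma uniquely_nil_cleanD:
  assumes "uniquely_nil_clean_element R r"
    and "q \<in> nilpotents R" "e \<in> idempotents R" "r = q \<oplus> e"
    and "q' \<in> nilpotents R" "e' \<in> idempotents R" "r = q' \<oplus> e'"
  shows "e = e'"
proof -
  have "(q, e) = (q', e')"
    using assms unfolding uniquely_nil_clean_element_def by (elim ex1E) (metis SigmaI fst_conv snd_conv)
  then show ?thesis by simp
qed

lemma idempotent_clean:
  assumes "e \<in> idempotents R"
  shows "clean_element R e"
proof -
  let ?f = "\<one> \<ominus> e"
  have e: "e \<in> carrier R" "e \<otimes> e = e" using assms unfolding idempotents_def by auto
  note f = one_minus_idempotent[OF assms]
  have fc: "?f \<in> carrier R" "?f \<otimes> ?f = ?f" using f unfolding idempotents_def by auto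
  have ef: "e \<oplus> ?f = \<one>" using e by (simp add: minus_eq a_lcomm[of e] r_neg)
  \<comment> \<open>Orthogonality of \<open>e\<close> and \<open>?f\<close> kills the mixed terms,
    so \<open>e \<ominus> ?f\<close> is its own inverse.\<close>
  have "(e \<ominus> ?f) \<otimes> (e \<ominus> ?f) = e \<otimes> e \<oplus> \<ominus> (e \<otimes> ?f) \<oplus> \<ominus> (?f \<otimes> e) \<oplus> ?f \<otimes> ?f"
    using e(1) fc(1) unfolding minus_eq[of e ?f] by algebra
  also have "\<dots> = \<one>" using e fc f ef by simp
  finally have "e \<ominus> ?f \<in> Units R" using e fc unfolding Units_def by auto
  moreover have "e = (e \<ominus> ?f) \<oplus> ?f" using e(1) fc(1) unfolding minus_eq[of e ?f]
    by (simp add: a_assoc l_neg)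
  ultimately show ?thesis using f(1) unfolding clean_element_def by blast
qed

text \<open>The last hypothesis covers both off-diagonal Peirce corners at once: in either, one of
  the products \<open>e \<otimes> n\<close> and \<open>n \<otimes> e\<close> is \<open>n\<close> and
  the other is zero. Together with \<open>n \<otimes> n = \<zero>\<close> it makes
  \<open>e \<oplus> n\<close> idempotent.\<close>

lemma uniquely_nil_clean_idempotent_corner:
  assumes "uniquely_nil_clean_element R e" "e \<in> idempotents R" "n \<in> carrier R"
    and "n \<otimes> n = \<zero>" "e \<otimes> n \<oplus> n \<otimes> e = n"
  shows "n = \<zero>"
proof -
  have e: "e \<in> carrier R" "e \<otimes> e = e" using assms unfolding idempotents_def by auto
  have "(e \<oplus> n) \<otimes> (e \<oplus> n) = e \<otimes> e \<oplus> (e \<otimes> n \<oplus> n \<otimes> e) \<oplus> n \<otimes> n"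
    using e(1) assms(3) by algebra
  then have "e \<oplus> n \<in> idempotents R"
    using e assms(3-5) unfolding idempotents_def by simp
  moreover have "\<ominus> n \<in> nilpotents R"
    using assms by (intro nilpotent_minus square_zero_nilpotent)
  moreover have "e = \<ominus> n \<oplus> (e \<oplus> n)" using e assms(3) by algebra
  moreover have "e = \<zero> \<oplus> e" using e by simp
  ultimately have "e = e \<oplus> n"
    using uniquely_nil_cleanD[OF assms(1) zero_nilpotent assms(2)] by blast
  then show ?thesis using e assms(3) by simp
qed

lemma uniquely_nil_clean_idempotent_central:
  assumes u: "uniquely_nil_clean_element R e" and i: "e \<in> idempotents R" and x: "x \<in> carrier R"
  shows "e \<otimes> x = x \<otimes> e"
proof -
  let ?f = "\<one> \<ominus> e"
  have e: "e \<in> carrier R" "e \<otimes> e = e" using i unfolding idempotents_def by auto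
  note f = one_minus_idempotent[OF i]
  have fc: "?f \<in> carrier R" using f unfolding idempotents_def by auto
  \<comment> \<open>Idempotence and orthogonality in the form that applies inside products nested to
    the right.\<close>
  have z: "?f \<otimes> (e \<otimes> y) = \<zero>" "e \<otimes> (?f \<otimes> y) = \<zero>" "e \<otimes> (e \<otimes> y) = e \<otimes> y"
    if "y \<in> carrier R" for y
    using f e fc that by (simp_all add: m_assoc[symmetric])
  have "e \<otimes> x \<otimes> ?f = \<zero>"
    by (rule uniquely_nil_clean_idempotent_corner[OF u i]) (use e f fc z x in \<open>simp_all add: m_assoc\<close>)
  moreover have "?f \<otimes> x \<otimes> e = \<zero>"
    by (rule uniquely_nil_clean_idempotent_corner[OF u i]) (use e f fc z x in \<open>simp_all add: m_assoc\<close>)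
  \<comment> \<open>Both corners subtract the same \<open>e \<otimes> x \<otimes> e\<close>, so
    their vanishing equates \<open>e \<otimes> x\<close> and \<open>x \<otimes> e\<close>.\<close>
  moreover have "e \<otimes> x \<otimes> ?f = e \<otimes> x \<ominus> e \<otimes> x \<otimes> e" "?f \<otimes> x \<otimes> e = x \<otimes> e \<ominus> e \<otimes> x \<otimes> e"
    using e(1) x by (simp_all add: minus_eq r_distr l_distr r_minus l_minus m_assoc)
  ultimately show ?thesis using e(1) x by (metis eq_if_minus_zero m_closed)
qed

lemma uniquely_nil_clean_Unit:
  assumes u: "u \<in> Units R" and unc: "uniquely_nil_clean_element R u"
  shows "\<exists>q \<in> nilpotents R. u = \<one> \<oplus> q"
proof -
  obtain q e where q: "q \<in> nilpotents R" and e: "e \<in> idempotents R" and uqe: "u = q \<oplus> e"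
    using unc unfolding uniquely_nil_clean_element_def by (metis mem_Times_iff)
  obtain n :: nat where n: "n > 0" "q [^] n = \<zero>" and qc: "q \<in> carrier R"
    using q unfolding nilpotents_def by auto
  have ec: "e \<in> carrier R" "e \<otimes> e = e" using e unfolding idempotents_def by auto
  have uc: "u \<in> carrier R" "inv u \<in> carrier R" "inv u \<otimes> u = \<one>" "u \<otimes> inv u = \<one>" using u by auto
  have iu: "inv u \<otimes> (u \<otimes> y) = y" if "y \<in> carrier R" for y
    using uc that by (simp add: m_assoc[symmetric])
  \<comment> \<open>Conjugation commutes with powers, so the conjugate of \<open>q\<close> is
    nilpotent with the same exponent.\<close>
  have conj_pow: "(u \<otimes> x \<otimes> inv u) [^] k = u \<otimes> x [^] k \<otimes> inv u" if "x \<in> carrier R" for x and k :: nat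
    by (induction k) (use uc iu that in \<open>simp_all add: m_assoc\<close>)
  have "u \<otimes> q \<otimes> inv u \<in> nilpotents R"
    using n qc uc conj_pow[OF qc, of n] unfolding nilpotents_def by auto
  moreover have "u \<otimes> e \<otimes> inv u \<in> idempotents R"
    using ec uc iu unfolding idempotents_def by (simp add: m_assoc) (simp add: m_assoc[symmetric])
  moreover have "u = u \<otimes> q \<otimes> inv u \<oplus> u \<otimes> e \<otimes> inv u"
  proof -
    have "u \<otimes> q \<otimes> inv u \<oplus> u \<otimes> e \<otimes> inv u = u \<otimes> (q \<oplus> e) \<otimes> inv u"
      using qc ec uc by (simp add: r_distr l_distr)
    also have "\<dots> = u" using uc by (simp add: uqe[symmetric] m_assoc)
    finally show ?thesis by simp
  qed
  ultimately have "e = u \<otimes> e \<otimes> inv u" using uniquely_nil_cleanD[OF unc q e uqe] by blast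
  then have "e \<otimes> u = u \<otimes> e \<otimes> inv u \<otimes> u" by simp
  then have eu: "e \<otimes> u = u \<otimes> e" using ec uc by (simp add: m_assoc)
  \<comment> \<open>Substituting \<open>u = q \<oplus> e\<close> turns commutation of
    \<open>e\<close> with \<open>u\<close> into commutation of \<open>e\<close> with
    \<open>q\<close>, and then of \<open>u\<close> with \<open>q\<close>.\<close>
  have "e \<otimes> q \<oplus> e = q \<otimes> e \<oplus> e" using eu qc ec unfolding uqe by (simp add: r_distr l_distr)
  then have "e \<otimes> q = q \<otimes> e" using qc ec by simp
  then have uq: "u \<otimes> q = q \<otimes> u" using qc ec unfolding uqe by (simp add: r_distr l_distr)
  let ?f = "\<one> \<ominus> e"
  have fc: "?f \<in> carrier R" using ec by simp
  have uf: "u \<otimes> ?f = q \<otimes> ?f"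
    using qc ec fc one_minus_idempotent[OF e] unfolding uqe by (simp add: l_distr)
  \<comment> \<open>On \<open>?f\<close> each factor \<open>u\<close> acts as \<open>q\<close>, and
    commutation lets \<open>q\<close> move out to the left. At exponent \<open>n\<close> the right
    side vanishes, so the unit \<open>u [^] n\<close> annihilates \<open>?f\<close>, which forces
    \<open>?f = \<zero>\<close>.\<close>
  have "u [^] k \<otimes> ?f = q [^] k \<otimes> ?f" for k :: nat
  proof (induction k)
    case (Suc k)
    have "u [^] Suc k \<otimes> ?f = u [^] k \<otimes> q \<otimes> ?f" using uc qc fc uf by (simp add: m_assoc)
    also have "\<dots> = q \<otimes> (u [^] k \<otimes> ?f)" using group_commutes_pow[OF uq uc(1) qc] uc qc fc by (simp add: m_assoc)
    also have "\<dots> = q [^] Suc k \<otimes> ?f" using qc fc unfolding Suc nat_pow_Suc2[OF qc]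
      by (simp add: m_assoc)
    finally show ?case .
  qed (use fc in simp)
  then have "u [^] n \<otimes> ?f = \<zero>" using n fc by simp
  moreover have "u [^] n \<in> Units R" by (induction n) (use u in simp_all)
  ultimately have "?f = \<zero>" using fc by (metis Units_closed Units_l_cancel r_null zero_closed)
  then have "e = \<one>" using ec eq_if_minus_zero[of \<one> e] by simp
  then show ?thesis using q qc uqe a_comm by auto
qed

lemma CUNC_imp_abelian_UU:
  assumes "CUNC_ring R"
  shows "abelian_ring R \<and> UU_ring R"
proof
  have unc: "uniquely_nil_clean_element R r" if "r \<in> carrier R" "clean_element R r" for r
    using assms that unfolding CUNC_ring_def by auto
  show "abelian_ring R"
    unfolding abelian_ring_def
    using uniquely_nil_clean_idempotent_central unc idempotent_clean ring_axioms
    by (auto simp: idempotents_def)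
  have "uniquely_nil_clean_element R u" if "u \<in> Units R" for u
  proof (rule unc)
    have "\<zero> \<in> idempotents R" unfolding idempotents_def by simp
    then show "clean_element R u" unfolding clean_element_def using that
      by (metis Units_closed r_zero)
  qed (use that in auto)
  then have "Units R = (\<lambda>q. \<one> \<oplus> q) ` nilpotents R"
    using uniquely_nil_clean_Unit one_plus_nilpotent_Unit by blast
  then show "UU_ring R" unfolding UU_ring_def using ring_axioms by simp
qed

section \<open>Abelian UU-rings are CUNC-rings\<close>

lemma UU_imp_two_nilpotent:
  assumes "UU_ring R"
  shows "\<one> \<oplus> \<one> \<in> nilpotents R"
proof -
  have "\<ominus> \<one> \<in> Units R" unfolding Units_def by (auto simp: l_minus r_minus intro!: bexI[of _ "\<ominus> \<one>"])
  then obtain q where q: "q \<in> nilpotents R" "\<ominus> \<one> = \<one> \<oplus> q"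
    using assms unfolding UU_ring_def by auto
  have "q \<in> carrier R" using q unfolding nilpotents_def by auto
  then have "\<ominus> q = \<one> \<oplus> \<ominus> (\<one> \<oplus> q)" by algebra
  then have "\<ominus> q = \<one> \<oplus> \<one>" using q(2) by (metis minus_minus one_closed)
  then show ?thesis using nilpotent_minus[OF q(1)] by simp
qed

lemma abelian_nil_clean_unique:
  assumes ab: "abelian_ring R"
    and q: "q \<in> nilpotents R" and e: "e \<in> idempotents R"
    and q': "q' \<in> nilpotents R" and e': "e' \<in> idempotents R"
    and eq: "q \<oplus> e = q' \<oplus> e'"
  shows "q = q' \<and> e = e'"
proof -
  have c: "q \<in> carrier R" "q' \<in> carrier R" "e \<in> carrier R" "e' \<in> carrier R"
    and id: "e \<otimes> e = e" "e' \<otimes> e' = e'"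
    using q q' e e' unfolding nilpotents_def idempotents_def by auto
  have cen: "e \<otimes> x = x \<otimes> e" "e' \<otimes> x = x \<otimes> e'" if "x \<in> carrier R" for x
    using ab e e' that unfolding abelian_ring_def by auto
  let ?d = "e \<ominus> e'"
  have dc: "?d \<in> carrier R" using c by simp
  have "?d = (q \<oplus> e) \<oplus> \<ominus> q \<oplus> \<ominus> e'" using c unfolding minus_eq by algebra
  also have "\<dots> = q' \<oplus> \<ominus> q" using c unfolding eq by algebra
  finally have d: "?d = q' \<oplus> \<ominus> q" .
  \<comment> \<open>A sum of nilpotents is known to be nilpotent only if they commute. Here
    \<open>q'\<close> differs from \<open>q\<close> by \<open>?d\<close>, which commutes with
    \<open>q\<close> as a difference of central idempotents.\<close>
  have "q' = q \<oplus> ?d" using c unfolding d by algebra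
  moreover have "?d \<otimes> q = q \<otimes> ?d"
    using c cen[OF c(1)] by (simp add: minus_eq l_distr r_distr l_minus r_minus)
  ultimately have "q' \<otimes> q = q \<otimes> q'" using c dc by (simp add: l_distr r_distr)
  then have "q' \<otimes> \<ominus> q = \<ominus> q \<otimes> q'" using c by (simp add: l_minus r_minus)
  then have dn: "?d \<in> nilpotents R"
    unfolding d by (intro nilpotent_add q' nilpotent_minus q)
  have ee: "e' \<otimes> e = e \<otimes> e'" using cen(2)[OF c(3)] .
  have eee: "e \<otimes> (e \<otimes> e') = e \<otimes> e'" "e' \<otimes> (e \<otimes> e') = e \<otimes> e'"
  proof -
    show "e \<otimes> (e \<otimes> e') = e \<otimes> e'" using c id(1) by (simp add: m_assoc[symmetric])
    have "e' \<otimes> (e \<otimes> e') = e' \<otimes> e \<otimes> e'" using c by (simp add: m_assoc)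
    also have "\<dots> = e \<otimes> (e' \<otimes> e')" unfolding ee using c by (simp add: m_assoc)
    finally show "e' \<otimes> (e \<otimes> e') = e \<otimes> e'" unfolding id .
  qed
  have d2: "?d \<otimes> ?d = (e \<oplus> e') \<oplus> \<ominus> (e \<otimes> e' \<oplus> e \<otimes> e')"
  proof -
    have "?d \<otimes> ?d = e \<otimes> e \<oplus> \<ominus> (e \<otimes> e') \<oplus> \<ominus> (e' \<otimes> e) \<oplus> e' \<otimes> e'"
      using c unfolding minus_eq by algebra
    also have "\<dots> = (e \<oplus> e') \<oplus> \<ominus> (e \<otimes> e' \<oplus> e \<otimes> e')"
      using c unfolding id ee by algebra
    finally show ?thesis .
  qed
  \<comment> \<open>All mixed products reduce to \<open>e \<otimes> e'\<close>, and their
    coefficients 1, -2, -1 and 2 add up to zero.\<close>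
  have d3: "?d \<otimes> (?d \<otimes> ?d) = ?d"
  proof -
    have "?d \<otimes> (?d \<otimes> ?d) = e \<otimes> e \<oplus> e \<otimes> e' \<oplus> \<ominus> (e \<otimes> (e \<otimes> e') \<oplus> e \<otimes> (e \<otimes> e'))
        \<oplus> \<ominus> (e' \<otimes> e) \<oplus> \<ominus> (e' \<otimes> e') \<oplus> (e' \<otimes> (e \<otimes> e') \<oplus> e' \<otimes> (e \<otimes> e'))"
      unfolding d2 unfolding minus_eq using c by algebra
    also have "\<dots> = ?d" unfolding eee id ee unfolding minus_eq using c by algebra
    finally show ?thesis .
  qed
  \<comment> \<open>By \<open>d3\<close> the square of \<open>?d\<close> is idempotent; being
    nilpotent as well it is zero, and \<open>d3\<close> then gives
    \<open>?d = \<zero>\<close>.\<close>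
  have "?d \<otimes> ?d \<in> idempotents R"
    unfolding idempotents_def using dc d3 by (simp add: m_assoc)
  moreover have "?d \<otimes> ?d \<in> nilpotents R" by (rule nilpotent_mult) (use dn dc in auto)
  ultimately have "?d \<otimes> ?d = \<zero>" using idempotent_nilpotent_eq_zero by blast
  then have "?d = \<zero>" using d3 dc by simp
  then have "e = e'" using c eq_if_minus_zero by blast
  then show ?thesis using eq c by simp
qed

lemma abelian_UU_imp_CUNC:
  assumes ab: "abelian_ring R" and uu: "UU_ring R"
  shows "CUNC_ring R"
  unfolding CUNC_ring_def
proof (intro conjI ballI impI)
  show "ring R" by (rule ring_axioms)
  fix r assume "clean_element R r"
  then obtain u e where u: "u \<in> Units R" and e: "e \<in> idempotents R" and r: "r = u \<oplus> e"
    unfolding clean_element_def by auto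
  obtain q where q: "q \<in> nilpotents R" and uq: "u = \<one> \<oplus> q"
    using u uu unfolding UU_ring_def by auto
  have c: "q \<in> carrier R" "e \<in> carrier R"
    using q e unfolding nilpotents_def idempotents_def by auto
  have eq: "e \<otimes> q = q \<otimes> e" using ab e c unfolding abelian_ring_def by auto
  have "(\<one> \<oplus> \<one>) \<otimes> e \<in> nilpotents R"
    by (rule nilpotent_mult) (use UU_imp_two_nilpotent[OF uu] c in \<open>auto simp: l_distr r_distr\<close>)
  \<comment> \<open>Centrality of \<open>e\<close> supplies the commutation of the two nilpotent
    summands.\<close>
  then have "q \<oplus> (\<one> \<oplus> \<one>) \<otimes> e \<in> nilpotents R"
    using q c eq by (intro nilpotent_add) (simp_all add: l_distr r_distr)
  moreover have "\<one> \<ominus> e \<in> idempotents R" using one_minus_idempotent[OF e] by simp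
  moreover have "r = (q \<oplus> (\<one> \<oplus> \<one>) \<otimes> e) \<oplus> (\<one> \<ominus> e)"
    unfolding r uq minus_eq using c by algebra
  ultimately show "uniquely_nil_clean_element R r"
    unfolding uniquely_nil_clean_element_def
    by (intro ex1I[of _ "(q \<oplus> (\<one> \<oplus> \<one>) \<otimes> e, \<one> \<ominus> e)"])
      (auto dest: abelian_nil_clean_unique[OF ab])
qed

end

theorem theorem3p1:
  fixes R :: "('a, 'm) ring_scheme"
  assumes "ring R"
  shows "CUNC_ring R \<longleftrightarrow> abelian_ring R \<and> UU_ring R"
  using ring.CUNC_imp_abelian_UU[OF assms] ring.abelian_UU_imp_CUNC[OF assms] by blast

end
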